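(* Let $T$ be a triangle in a quasi-thin scheme $(\Omega,S)$. Then $T$ is exceptional if and only if the set $\{1_\Omega\}\cup T^\perp$ is a subgroup of the group $S_1$ (under relational product) isomorphic to the Klein four-group.
   Context: A scheme is a pair $(\Omega,S)$ with $\Omega$ finite, $S$ a partition of $\Omega\times\Omega$ with $1_\Omega\in S$, $S$ closed under transposition $r\mapsto r^*$, and $|\alpha u\cap\gamma v^*|$ independent of $(\alpha,\gamma)\in w$ for $u,v,w\in S$. Quasi-thin: every basic relation $u$ has valency $|\alpha u|\in\{1,2\}$; $S_m$ is the set of basic relations of valency $m$; $S_1$ is a group under relational product $\cdot$. For $u,v\in S$, $uv$ is the set of basic relations contained in $u\cdot v$. For $u\in S_2$ there is a unique basic relation $u^\perp$ with $uu^*=\{1_\Omega,u^\perp\}$; for $T\subseteq S_2$, $T^\perp=\{u^\perp:u\in T\}$. Distinct $u,v\in S_2$ are adjacent if $|u^*v|=2$; a triangle is a $3$-subset of $S_2$ any two distinct elements of which are adjacent. A triangle $\{u,v,w\}$ is exceptional if $u^\perp\cdot v^\perp\cdot w^\perp=1_\Omega$. *)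

theory Defs
  imports "HOL-Algebra.Algebra" "HOL-Library.Disjoint_Sets"
begin

text \<open>
  Relations on \<open>\<Omega>\<close> are subsets of \<open>\<Omega> \<times> \<Omega>\<close>: \<open>1\<^sub>\<Omega>\<close> is \<open>Id_on \<Omega>\<close>, \<open>r\<^sup>*\<close> is \<open>converse r\<close>,
  \<open>\<alpha>u\<close> is \<open>u `` {\<alpha>}\<close>, and the relational product \<open>u \<cdot> v\<close> is \<open>u O v\<close>.
\<close>

definition scheme :: "'a set \<Rightarrow> 'a rel set \<Rightarrow> bool" where
  "scheme \<Omega> S \<longleftrightarrow>
     finite \<Omega> \<and>
     partition_on (\<Omega> \<times> \<Omega>) S \<and>
     Id_on \<Omega> \<in> S \<and>
     (\<forall>r\<in>S. converse r \<in> S) \<and>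
     (\<forall>u\<in>S. \<forall>v\<in>S. \<forall>w\<in>S. \<exists>c. \<forall>(\<alpha>, \<gamma>)\<in>w. card (u `` {\<alpha>} \<inter> converse v `` {\<gamma>}) = c)"

definition quasi_thin :: "'a set \<Rightarrow> 'a rel set \<Rightarrow> bool" where
  "quasi_thin \<Omega> S \<longleftrightarrow> scheme \<Omega> S \<and> (\<forall>u\<in>S. \<forall>\<alpha>\<in>\<Omega>. card (u `` {\<alpha>}) \<in> {1, 2})"

text \<open>
  \<open>S\<^sub>m\<close>, the basic relations of valency \<open>m\<close>. In a scheme, \<open>card (u `` {\<alpha>})\<close> does not depend
  on \<open>\<alpha> \<in> \<Omega>\<close>, and \<open>\<Omega>\<close> is nonempty because \<open>Id_on \<Omega>\<close> belongs to a partition.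
\<close>

definition basic_of_valency :: "'a set \<Rightarrow> 'a rel set \<Rightarrow> nat \<Rightarrow> 'a rel set" where
  "basic_of_valency \<Omega> S m = {u \<in> S. \<forall>\<alpha>\<in>\<Omega>. card (u `` {\<alpha>}) = m}"

definition thin_group :: "'a set \<Rightarrow> 'a rel set \<Rightarrow> 'a rel monoid" where
  "thin_group \<Omega> S = \<lparr>carrier = basic_of_valency \<Omega> S 1, monoid.mult = (O), one = Id_on \<Omega>\<rparr>"

definition complex_product :: "'a rel set \<Rightarrow> 'a rel \<Rightarrow> 'a rel \<Rightarrow> 'a rel set" where
  "complex_product S u v = {w \<in> S. w \<subseteq> u O v}"

text \<open>Meaningful for \<open>u\<close> of valency 2 in a quasi-thin scheme, where \<open>v\<close> exists and is unique.\<close>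

definition perp :: "'a set \<Rightarrow> 'a rel set \<Rightarrow> 'a rel \<Rightarrow> 'a rel" where
  "perp \<Omega> S u = (THE v. v \<in> S \<and> complex_product S u (converse u) = {Id_on \<Omega>, v})"

definition adjacent :: "'a set \<Rightarrow> 'a rel set \<Rightarrow> 'a rel \<Rightarrow> 'a rel \<Rightarrow> bool" where
  "adjacent \<Omega> S u v \<longleftrightarrow>
     u \<in> basic_of_valency \<Omega> S 2 \<and> v \<in> basic_of_valency \<Omega> S 2 \<and> u \<noteq> v \<and>
     card (complex_product S (converse u) v) = 2"

definition scheme_triangle :: "'a set \<Rightarrow> 'a rel set \<Rightarrow> 'a rel set \<Rightarrow> bool" where
  "scheme_triangle \<Omega> S T \<longleftrightarrow>
     T \<subseteq> basic_of_valency \<Omega> S 2 \<and> card T = 3 \<and>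
     (\<forall>u\<in>T. \<forall>v\<in>T. u \<noteq> v \<longrightarrow> adjacent \<Omega> S u v)"

text \<open>
  The order in which a triangle is enumerated is irrelevant: every \<open>perp \<Omega> S u\<close> is symmetric,
  so if the product is \<open>Id_on \<Omega>\<close> then the three factors are commuting involutions of valency 1.
\<close>

definition exceptional :: "'a set \<Rightarrow> 'a rel set \<Rightarrow> 'a rel set \<Rightarrow> bool" where
  "exceptional \<Omega> S T \<longleftrightarrow>
     scheme_triangle \<Omega> S T \<and>
     (\<exists>u v w. T = {u, v, w} \<and> perp \<Omega> S u O perp \<Omega> S v O perp \<Omega> S w = Id_on \<Omega>)"

definition klein_four_group :: "(int \<times> int) monoid" where
  "klein_four_group = integer_mod_group 2 \<times>\<times> integer_mod_group 2"

end

theory Submission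
  imports Defs
begin

text \<open>
  Each \<open>u\<^sup>\<bottom>\<close> is symmetric and differs from \<open>1\<^sub>\<Omega>\<close>, so it is an involution as soon as it is thin. If
  \<open>u\<^sup>\<bottom> \<cdot> v\<^sup>\<bottom> \<cdot> w\<^sup>\<bottom> = 1\<^sub>\<Omega>\<close>, comparing valencies makes all three factors thin, and they are
  distinct involutions with \<open>u\<^sup>\<bottom> \<cdot> v\<^sup>\<bottom> = w\<^sup>\<bottom>\<close>. Conversely, in a group of order four whose
  nonidentity elements are involutions, the product of two of them is the third.
\<close>

section \<open>Recognising the Klein four-group\<close>

lemma klein_four_groupI:
  assumes "group G" and ab: "a \<in> carrier G" "b \<in> carrier G"
    and ne: "a \<noteq> \<one>\<^bsub>G\<^esub>" "b \<noteq> \<one>\<^bsub>G\<^esub>" "a \<noteq> b"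
    and sq: "a \<otimes>\<^bsub>G\<^esub> a = \<one>\<^bsub>G\<^esub>" "b \<otimes>\<^bsub>G\<^esub> b = \<one>\<^bsub>G\<^esub>"
    and comm: "a \<otimes>\<^bsub>G\<^esub> b = b \<otimes>\<^bsub>G\<^esub> a"
    and carr: "carrier G = {\<one>\<^bsub>G\<^esub>, a, b, a \<otimes>\<^bsub>G\<^esub> b}"
  shows "G \<cong> klein_four_group"
proof -
  interpret G: group G by fact
  have cK: "carrier klein_four_group = {(0, 0), (1, 0), (0, 1), (1, 1)}"
    by (auto simp: klein_four_group_def DirProd_def carrier_integer_mod_group)
  have mK: "x \<otimes>\<^bsub>klein_four_group\<^esub> y = ((fst x + fst y) mod 2, (snd x + snd y) mod 2)" for x y
    by (simp add: klein_four_group_def DirProd_def integer_mod_group_def split: prod.splits)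
  \<comment> \<open>The isomorphism sends the exponent pair (i, j) to a^i b^j; \<open>carr\<close>
    says that its four values exhaust the group.\<close>
  define h :: "int \<times> int \<Rightarrow> 'a" where
    "h x = (if fst x = 0 then \<one>\<^bsub>G\<^esub> else a) \<otimes>\<^bsub>G\<^esub> (if snd x = 0 then \<one>\<^bsub>G\<^esub> else b)" for x
  \<comment> \<open>The relations between a and b are repeated with a trailing factor: once
    \<open>G.m_assoc\<close> has bracketed a word to the right, these rules cancel and sort letters
    inside it, which settles the homomorphism check.\<close>
  have cancel: "a \<otimes>\<^bsub>G\<^esub> (a \<otimes>\<^bsub>G\<^esub> x) = x" "b \<otimes>\<^bsub>G\<^esub> (b \<otimes>\<^bsub>G\<^esub> x) = x"
    "b \<otimes>\<^bsub>G\<^esub> (a \<otimes>\<^bsub>G\<^esub> x) = a \<otimes>\<^bsub>G\<^esub> (b \<otimes>\<^bsub>G\<^esub> x)" if "x \<in> carrier G" for x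
    using ab sq comm that by (simp_all flip: G.m_assoc)
  have ab_ne: "a \<otimes>\<^bsub>G\<^esub> b \<noteq> \<one>\<^bsub>G\<^esub>" "a \<otimes>\<^bsub>G\<^esub> b \<noteq> a" "a \<otimes>\<^bsub>G\<^esub> b \<noteq> b"
    using ab ne sq by (metis G.l_cancel) (use ab ne in auto)
  have h_vals: "h (0, 0) = \<one>\<^bsub>G\<^esub>" "h (1, 0) = a" "h (0, 1) = b" "h (1, 1) = a \<otimes>\<^bsub>G\<^esub> b"
    using ab by (simp_all add: h_def)
  have "h \<in> hom klein_four_group G"
    using ab sq comm[symmetric] cancel by (auto simp: hom_def cK mK h_def G.m_assoc)
  moreover have "bij_betw h (carrier klein_four_group) (carrier G)"
    unfolding bij_betw_def cK carr
    using ne ne[symmetric] ab_ne ab_ne[symmetric] by (simp add: h_vals insert_commute)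
  ultimately have "klein_four_group \<cong> G"
    by (auto simp: is_iso_def iso_def)
  moreover have "group klein_four_group"
    by (simp add: klein_four_group_def DirProd_group)
  ultimately show ?thesis
    by (simp add: group.iso_sym)
qed

lemma card_klein_four_group: "card (carrier klein_four_group) = 4"
  by (simp add: klein_four_group_def DirProd_def carrier_integer_mod_group card_cartesian_product)

section \<open>Points, intersection numbers and valencies in a scheme\<close>

lemma scheme_subset:
  assumes "scheme \<Omega> S" "u \<in> S" "(\<alpha>, \<beta>) \<in> u"
  shows "\<alpha> \<in> \<Omega>" "\<beta> \<in> \<Omega>"
  using assms unfolding scheme_def partition_on_def by blast+

lemma scheme_cover:
  assumes "scheme \<Omega> S" "\<alpha> \<in> \<Omega>" "\<beta> \<in> \<Omega>"
  obtains w where "w \<in> S" "(\<alpha>, \<beta>) \<in> w"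
  using assms unfolding scheme_def partition_on_def by blast

lemma scheme_disjoint:
  assumes "scheme \<Omega> S" "u \<in> S" "v \<in> S" "p \<in> u" "p \<in> v"
  shows "u = v"
proof -
  have "disjoint S"
    using assms(1) by (auto simp: scheme_def partition_on_def)
  then have "u \<noteq> v \<Longrightarrow> u \<inter> v = {}"
    using assms(2,3) by (rule disjointD)
  then show ?thesis using assms(4,5) by blast
qed

lemma scheme_converse: "scheme \<Omega> S \<Longrightarrow> u \<in> S \<Longrightarrow> converse u \<in> S"
  by (simp add: scheme_def)

lemma scheme_Id: "scheme \<Omega> S \<Longrightarrow> Id_on \<Omega> \<in> S"
  by (simp add: scheme_def)

lemma finite_neighbours:
  assumes "scheme \<Omega> S" "u \<in> S"
  shows "finite (u `` {\<alpha>})"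
proof (rule finite_subset)
  show "u `` {\<alpha>} \<subseteq> \<Omega>" using scheme_subset(2)[OF assms] by auto
  show "finite \<Omega>" using assms(1) by (simp add: scheme_def)
qed

lemma scheme_intersection_number:
  assumes "scheme \<Omega> S" "u \<in> S" "v \<in> S" "w \<in> S" "(\<alpha>, \<gamma>) \<in> w" "(\<alpha>', \<gamma>') \<in> w"
  shows "card (u `` {\<alpha>} \<inter> converse v `` {\<gamma>}) = card (u `` {\<alpha>'} \<inter> converse v `` {\<gamma>'})"
proof -
  from assms(1-4) obtain c where
    c: "\<forall>(\<alpha>, \<gamma>)\<in>w. card (u `` {\<alpha>} \<inter> converse v `` {\<gamma>}) = c"
    unfolding scheme_def by blast
  show ?thesis using c[THEN bspec, OF assms(5)] c[THEN bspec, OF assms(6)] by simp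
qed

text \<open>A pair lies in \<open>u O v\<close> exactly when its intersection number for u and v is
  nonzero, and that number is constant on w. Hence one common pair forces inclusion.\<close>

lemma basic_subset_product:
  assumes S: "scheme \<Omega> S" "u \<in> S" "v \<in> S" "w \<in> S" and p: "p \<in> w" "p \<in> u O v"
  shows "w \<subseteq> u O v"
proof
  fix q assume q: "q \<in> w"
  have mem: "(\<alpha>, \<gamma>) \<in> u O v \<longleftrightarrow> card (u `` {\<alpha>} \<inter> converse v `` {\<gamma>}) \<noteq> 0" for \<alpha> \<gamma>
    using finite_neighbours[OF S(1,2)] by (auto simp: card_eq_0_iff)
  obtain \<alpha> \<gamma> \<alpha>' \<gamma>' where eqs: "p = (\<alpha>, \<gamma>)" "q = (\<alpha>', \<gamma>')" by (metis surj_pair)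
  from scheme_intersection_number[OF S, of \<alpha> \<gamma> \<alpha>' \<gamma>'] p q show "q \<in> u O v"
    unfolding eqs mem by simp
qed

text \<open>The valency at \<alpha> is the intersection number of u and its transpose at the
  diagonal pair (\<alpha>, \<alpha>), and all diagonal pairs lie in the one basic relation
  \<open>Id_on \<Omega>\<close>.\<close>

lemma valency_constant:
  assumes "scheme \<Omega> S" "u \<in> S" "\<alpha> \<in> \<Omega>" "\<beta> \<in> \<Omega>"
  shows "card (u `` {\<alpha>}) = card (u `` {\<beta>})"
  using scheme_intersection_number[OF assms(1,2) scheme_converse[OF assms(1,2)]
      scheme_Id[OF assms(1)], of \<alpha> \<alpha> \<beta> \<beta>] assms(3,4) by auto

lemma basic_of_valencyI:
  assumes "scheme \<Omega> S" "u \<in> S" "\<alpha> \<in> \<Omega>" "card (u `` {\<alpha>}) = m"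
  shows "u \<in> basic_of_valency \<Omega> S m"
proof -
  have "card (u `` {\<beta>}) = m" if "\<beta> \<in> \<Omega>" for \<beta>
    using valency_constant[OF assms(1,2) that assms(3)] assms(4) by simp
  with assms(2) show ?thesis by (simp add: basic_of_valency_def)
qed

lemma scheme_nonempty:
  assumes "scheme \<Omega> S"
  obtains \<alpha> where "\<alpha> \<in> \<Omega>"
  using assms unfolding scheme_def partition_on_def by (metis Id_on_empty ex_in_conv)

text \<open>A block of a partition is nonempty, so the valency is positive at some point and
  therefore at every point.\<close>

lemma basic_total:
  assumes S: "scheme \<Omega> S" "u \<in> S" and "\<alpha> \<in> \<Omega>"
  obtains \<beta> where "(\<alpha>, \<beta>) \<in> u"
proof -
  from S obtain \<alpha>' \<beta>' where m: "(\<alpha>', \<beta>') \<in> u"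
    unfolding scheme_def partition_on_def by (metis ex_in_conv surj_pair)
  then have "card (u `` {\<alpha>'}) \<noteq> 0"
    using finite_neighbours[OF S] by (auto simp: card_eq_0_iff)
  then have "u `` {\<alpha>} \<noteq> {}"
    using valency_constant[OF S \<open>\<alpha> \<in> \<Omega>\<close> scheme_subset(1)[OF S m]] by auto
  with that show thesis by blast
qed

lemma card_basic:
  assumes S: "scheme \<Omega> S" and u: "u \<in> basic_of_valency \<Omega> S m"
  shows "card u = card \<Omega> * m"
proof -
  have uS: "u \<in> S" using u by (simp add: basic_of_valency_def)
  have "u = Sigma \<Omega> (\<lambda>\<alpha>. u `` {\<alpha>})"
    using scheme_subset[OF S uS] by auto
  also have "card \<dots> = (\<Sum>\<alpha>\<in>\<Omega>. card (u `` {\<alpha>}))"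
    using S finite_neighbours[OF S uS] by (auto intro!: card_SigmaI simp: scheme_def)
  also have "\<dots> = card \<Omega> * m"
    using u by (simp add: basic_of_valency_def)
  finally show ?thesis .
qed

text \<open>Double counting: u and its transpose have equally many pairs, and by
  \<open>card_basic\<close> each valency is that number divided by the number of points.\<close>

lemma converse_basic_of_valency:
  assumes S: "scheme \<Omega> S" and u: "u \<in> basic_of_valency \<Omega> S m"
  shows "converse u \<in> basic_of_valency \<Omega> S m"
proof -
  obtain \<alpha> where \<alpha>: "\<alpha> \<in> \<Omega>" using S by (rule scheme_nonempty)
  have conv: "converse u \<in> S"
    using u S by (simp add: basic_of_valency_def scheme_converse)
  define k where "k = card (converse u `` {\<alpha>})"
  have k: "converse u \<in> basic_of_valency \<Omega> S k"
    using basic_of_valencyI[OF S conv \<alpha>] by (simp add: k_def)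
  have "card \<Omega> * m = card \<Omega> * k"
    using card_basic[OF S u] card_basic[OF S k] by simp
  moreover have "card \<Omega> \<noteq> 0"
    using \<alpha> S by (auto simp: scheme_def)
  ultimately show ?thesis using k by simp
qed

section \<open>Thin relations and the group they form\<close>

lemma thin_unique:
  assumes S: "scheme \<Omega> S" and u: "u \<in> basic_of_valency \<Omega> S 1"
    and "(\<alpha>, \<beta>) \<in> u" "(\<alpha>, \<gamma>) \<in> u"
  shows "\<beta> = \<gamma>"
proof -
  have "\<alpha> \<in> \<Omega>"
    using assms scheme_subset(1)[OF S] by (auto simp: basic_of_valency_def)
  with u have "card (u `` {\<alpha>}) = 1" by (simp add: basic_of_valency_def)
  then show ?thesis using assms(3,4) by (metis Image_singleton_iff card_1_singletonE singletonD)
qed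

text \<open>Basic relations are total, so being single-valued already makes the valency equal to
  1.\<close>

lemma thinI:
  assumes S: "scheme \<Omega> S" "u \<in> S" and un: "\<And>\<alpha> \<beta> \<gamma>. (\<alpha>, \<beta>) \<in> u \<Longrightarrow> (\<alpha>, \<gamma>) \<in> u \<Longrightarrow> \<beta> = \<gamma>"
  shows "u \<in> basic_of_valency \<Omega> S 1"
proof -
  obtain \<alpha> where \<alpha>: "\<alpha> \<in> \<Omega>" using S(1) by (rule scheme_nonempty)
  obtain \<beta> where "(\<alpha>, \<beta>) \<in> u" using S \<alpha> by (rule basic_total)
  then have "u `` {\<alpha>} = {\<beta>}" using un by blast
  then show ?thesis by (intro basic_of_valencyI[OF S \<alpha>]) simp
qed

lemma thin_comp:
  assumes S: "scheme \<Omega> S" and u: "u \<in> basic_of_valency \<Omega> S 1" and v: "v \<in> basic_of_valency \<Omega> S 1"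
  shows "u O v \<in> basic_of_valency \<Omega> S 1"
proof -
  have uS: "u \<in> S" and vS: "v \<in> S" using u v by (auto simp: basic_of_valency_def)
  have un: "\<beta> = \<gamma>" if "(\<alpha>, \<beta>) \<in> u O v" "(\<alpha>, \<gamma>) \<in> u O v" for \<alpha> \<beta> \<gamma>
    using that thin_unique[OF S u] thin_unique[OF S v] by blast
  obtain \<alpha> where \<alpha>: "\<alpha> \<in> \<Omega>" using S by (rule scheme_nonempty)
  obtain \<beta> where \<beta>: "(\<alpha>, \<beta>) \<in> u" using S uS \<alpha> by (rule basic_total)
  obtain \<gamma> where \<gamma>: "(\<beta>, \<gamma>) \<in> v"
    using S vS scheme_subset(2)[OF S uS \<beta>] by (rule basic_total)
  obtain w where w: "w \<in> S" "(\<alpha>, \<gamma>) \<in> w"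
    using S \<alpha> scheme_subset(2)[OF S vS \<gamma>] by (rule scheme_cover)
  have sub: "w \<subseteq> u O v"
    using basic_subset_product[OF S uS vS w] \<beta> \<gamma> by blast
  \<comment> \<open>The block w is total and lies inside the single-valued product, so it contains
    every pair of the product; thus the product itself is basic.\<close>
  have "u O v \<subseteq> w"
  proof
    fix p assume p: "p \<in> u O v"
    then obtain \<alpha>' \<gamma>' where eq: "p = (\<alpha>', \<gamma>')" by (cases p) auto
    with p have "\<alpha>' \<in> \<Omega>" using scheme_subset(1)[OF S uS] by blast
    then obtain \<delta> where "(\<alpha>', \<delta>) \<in> w" using basic_total[OF S w(1)] by blast
    with p eq un sub show "p \<in> w" by blast
  qed
  with sub w(1) have "u O v \<in> S" by auto
  then show ?thesis using un by (rule thinI[OF S])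
qed

lemma Id_thin:
  assumes "scheme \<Omega> S"
  shows "Id_on \<Omega> \<in> basic_of_valency \<Omega> S 1"
  by (rule thinI[OF assms scheme_Id[OF assms]]) auto

lemma thin_converse_comp:
  assumes S: "scheme \<Omega> S" and u: "u \<in> basic_of_valency \<Omega> S 1"
  shows "converse u O u = Id_on \<Omega>"
proof -
  have uS: "u \<in> S" and cS: "converse u \<in> S"
    using u S by (auto simp: basic_of_valency_def scheme_converse)
  show ?thesis
  proof
    show "converse u O u \<subseteq> Id_on \<Omega>"
      using thin_unique[OF S u] scheme_subset(2)[OF S uS] by blast
    show "Id_on \<Omega> \<subseteq> converse u O u"
    proof
      fix p assume "p \<in> Id_on \<Omega>"
      then obtain \<alpha> where \<alpha>: "\<alpha> \<in> \<Omega>" "p = (\<alpha>, \<alpha>)" by blast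
      obtain \<beta> where "(\<alpha>, \<beta>) \<in> converse u" using S cS \<alpha>(1) by (rule basic_total)
      then show "p \<in> converse u O u" using \<alpha>(2) by blast
    qed
  qed
qed

lemma basic_comp_Id:
  assumes "scheme \<Omega> S" "u \<in> S"
  shows "Id_on \<Omega> O u = u" "u O Id_on \<Omega> = u"
proof -
  have "u \<subseteq> \<Omega> \<times> \<Omega>"
    using assms unfolding scheme_def partition_on_def by blast
  then show "Id_on \<Omega> O u = u" "u O Id_on \<Omega> = u" by blast+
qed

lemma thin_group_simps [simp]:
  "carrier (thin_group \<Omega> S) = basic_of_valency \<Omega> S 1"
  "u \<otimes>\<^bsub>thin_group \<Omega> S\<^esub> v = u O v"
  "\<one>\<^bsub>thin_group \<Omega> S\<^esub> = Id_on \<Omega>"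
  by (simp_all add: thin_group_def)

lemma group_thin_group:
  assumes S: "scheme \<Omega> S"
  shows "group (thin_group \<Omega> S)"
proof (rule groupI)
  fix u assume u: "u \<in> carrier (thin_group \<Omega> S)"
  show "\<exists>v\<in>carrier (thin_group \<Omega> S). v \<otimes>\<^bsub>thin_group \<Omega> S\<^esub> u = \<one>\<^bsub>thin_group \<Omega> S\<^esub>"
  proof
    show "converse u \<otimes>\<^bsub>thin_group \<Omega> S\<^esub> u = \<one>\<^bsub>thin_group \<Omega> S\<^esub>"
      using thin_converse_comp[OF S] u by simp
    show "converse u \<in> carrier (thin_group \<Omega> S)"
      using converse_basic_of_valency[OF S] u by simp
  qed
  show "\<one>\<^bsub>thin_group \<Omega> S\<^esub> \<otimes>\<^bsub>thin_group \<Omega> S\<^esub> u = u"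
    using u basic_comp_Id(1)[OF S] by (simp add: basic_of_valency_def)
qed (use thin_comp[OF S] Id_thin[OF S] in \<open>simp_all add: O_assoc\<close>)

section \<open>Existence and symmetry of the relation perp of u\<close>

text \<open>
  Each \<open>\<beta> \<in> \<alpha>u\<close> has exactly one \<open>u\<close>-predecessor other than \<open>\<alpha>\<close>, so \<open>\<alpha>(uu\<^sup>*)\<close> has at most two
  points other than \<open>\<alpha>\<close>. If they lay in different basic relations \<open>v\<close>, \<open>w\<close>, then \<open>v\<close> would be
  thin with \<open>u \<subseteq> v \<cdot> u\<close>, which makes both points of \<open>\<alpha>u\<close> neighbours of the \<open>v\<close>-image of \<open>\<alpha>\<close>.
\<close>
lemma perp_exists:
  assumes S: "scheme \<Omega> S" and u: "u \<in> basic_of_valency \<Omega> S 2"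
  obtains v where "v \<in> S" "v \<noteq> Id_on \<Omega>" "complex_product S u (converse u) = {Id_on \<Omega>, v}"
proof -
  have uS: "u \<in> S" and cS: "converse u \<in> S"
    using u S by (auto simp: basic_of_valency_def scheme_converse)
  obtain \<alpha> where \<alpha>: "\<alpha> \<in> \<Omega>" using S by (rule scheme_nonempty)
  have "card (u `` {\<alpha>}) = 2" using u \<alpha> by (simp add: basic_of_valency_def)
  then obtain \<beta>1 \<beta>2 where "u `` {\<alpha>} = {\<beta>1, \<beta>2}" by (meson card_2_iff)
  then have \<beta>: "(\<alpha>, \<beta>) \<in> u \<longleftrightarrow> \<beta> = \<beta>1 \<or> \<beta> = \<beta>2" for \<beta>
    by (metis Image_singleton_iff insert_iff singleton_iff)
  have pred: "\<exists>\<gamma>. \<gamma> \<noteq> \<alpha> \<and> (\<forall>\<delta>. (\<delta>, \<beta>) \<in> u \<longleftrightarrow> \<delta> = \<alpha> \<or> \<delta> = \<gamma>)" if "(\<alpha>, \<beta>) \<in> u" for \<beta>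
  proof -
    have "card (converse u `` {\<beta>}) = 2"
      using converse_basic_of_valency[OF S u] scheme_subset(2)[OF S uS that]
      by (simp add: basic_of_valency_def)
    then obtain x y where xy: "converse u `` {\<beta>} = {x, y}" "x \<noteq> y" by (meson card_2_iff)
    have "(\<delta>, \<beta>) \<in> u \<longleftrightarrow> \<delta> \<in> converse u `` {\<beta>}" for \<delta> by simp
    then have *: "(\<delta>, \<beta>) \<in> u \<longleftrightarrow> \<delta> = x \<or> \<delta> = y" for \<delta> unfolding xy(1) by simp
    with that have "\<alpha> = x \<or> \<alpha> = y" by simp
    with * xy(2) show ?thesis by metis
  qed
  obtain \<gamma>1 where \<gamma>1: "\<gamma>1 \<noteq> \<alpha>" "(\<delta>, \<beta>1) \<in> u \<longleftrightarrow> \<delta> = \<alpha> \<or> \<delta> = \<gamma>1" for \<delta>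
    using pred[of \<beta>1] \<beta>[of \<beta>1] by auto
  obtain \<gamma>2 where \<gamma>2: "\<gamma>2 \<noteq> \<alpha>" "(\<delta>, \<beta>2) \<in> u \<longleftrightarrow> \<delta> = \<alpha> \<or> \<delta> = \<gamma>2" for \<delta>
    using pred[of \<beta>2] \<beta>[of \<beta>2] by auto
  have nb: "(\<alpha>, \<gamma>) \<in> u O converse u \<longleftrightarrow> \<gamma> = \<alpha> \<or> \<gamma> = \<gamma>1 \<or> \<gamma> = \<gamma>2" for \<gamma>
    by (auto simp: relcomp_unfold \<beta> \<gamma>1(2) \<gamma>2(2))
  have in_S: "w \<in> complex_product S u (converse u) \<longleftrightarrow> w \<in> S \<and> w \<subseteq> u O converse u" for w
    by (simp add: complex_product_def)
  \<comment> \<open>By \<open>basic_subset_product\<close> a single pair decides, so membership in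
    the complex product can be tested on the neighbours of the fixed point \<alpha>.\<close>
  have in_iff: "w \<in> complex_product S u (converse u)"
    if "w \<in> S" "(\<alpha>, \<gamma>) \<in> w" "\<gamma> = \<alpha> \<or> \<gamma> = \<gamma>1 \<or> \<gamma> = \<gamma>2" for w \<gamma>
    using basic_subset_product[OF S uS cS that(1,2)] that(1,3) in_S nb by simp
  have not_Id: "(\<alpha>, \<alpha>) \<notin> w" if "w \<in> S" "w \<noteq> Id_on \<Omega>" for w
    using scheme_disjoint[OF S that(1) scheme_Id[OF S], of "(\<alpha>, \<alpha>)"] that \<alpha> by auto
  have no_split: "v = w"
    if vw: "v \<in> S" "w \<in> S" "v \<noteq> Id_on \<Omega>" and sub: "v \<subseteq> u O converse u"
      and \<delta>12: "(\<alpha>, \<delta>1) \<in> v" "(\<alpha>, \<delta>2) \<in> w"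
      and \<delta>: "\<delta>1 = \<gamma>1 \<and> \<delta>2 = \<gamma>2 \<or> \<delta>1 = \<gamma>2 \<and> \<delta>2 = \<gamma>1" for v w \<delta>1 \<delta>2
  proof (rule ccontr)
    assume "v \<noteq> w"
    then have v2: "(\<alpha>, \<delta>2) \<notin> v"
      using scheme_disjoint[OF S vw(1,2)] \<delta>12(2) by metis
    \<comment> \<open>Among the three candidates, \<alpha> is excluded because v is not the diagonal
      and \<delta>2 because it lies in the other block.\<close>
    have v\<alpha>: "\<epsilon> = \<delta>1" if "(\<alpha>, \<epsilon>) \<in> v" for \<epsilon>
    proof -
      have "\<epsilon> = \<alpha> \<or> \<epsilon> = \<gamma>1 \<or> \<epsilon> = \<gamma>2" using sub that nb by (metis subsetD)
      then show ?thesis using that v2 not_Id[OF vw(1,3)] \<delta> by metis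
    qed
    have "(\<alpha>, \<delta>1) \<in> u O converse u" using sub \<delta>12(1) ..
    then obtain \<beta>' where \<beta>': "(\<alpha>, \<beta>') \<in> u" "(\<delta>1, \<beta>') \<in> u"
      by (elim relcompE) auto
    \<comment> \<open>The path from \<alpha> through \<delta>1 to \<beta>' puts one pair of u into
      \<open>v O u\<close>.\<close>
    have "u \<subseteq> v O u"
      using basic_subset_product[OF S vw(1) uS uS \<beta>'(1)] relcompI[OF \<delta>12(1) \<beta>'(2)] by simp
    then have "(\<delta>1, \<beta>) \<in> u" if "(\<alpha>, \<beta>) \<in> u" for \<beta>
      using that v\<alpha> by (metis relcompEpair subsetD)
    then have "(\<delta>1, \<beta>1) \<in> u" "(\<delta>1, \<beta>2) \<in> u"
      using \<beta> by simp_all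
    \<comment> \<open>Apart from \<alpha>, the only predecessor of \<beta>1 is \<gamma>1 and that of
      \<beta>2 is \<gamma>2. As \<delta>1 differs from \<alpha> and precedes both, \<gamma>1 =
      \<gamma>2.\<close>
    then have "\<delta>1 = \<delta>2"
      using \<gamma>1 \<gamma>2 \<delta> by metis
    then show False using v2 \<delta>12(1) by simp
  qed
  have "(\<gamma>1, \<beta>1) \<in> u" using \<gamma>1(2) by simp
  then have "\<gamma>1 \<in> \<Omega>" by (rule scheme_subset(1)[OF S uS])
  \<comment> \<open>The block through (\<alpha>, \<gamma>1) is the candidate; any other nondiagonal
    block of the product would have to reach \<gamma>2 from \<alpha>, which \<open>no_split\<close>
    excludes.\<close>
  then obtain v where v: "v \<in> S" "(\<alpha>, \<gamma>1) \<in> v"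
    using scheme_cover[OF S \<alpha>] by blast
  have vne: "v \<noteq> Id_on \<Omega>" using v(2) \<gamma>1(1) by auto
  have v_in: "v \<in> complex_product S u (converse u)" using in_iff v by blast
  have uniq: "w = v" if w: "w \<in> complex_product S u (converse u)" "w \<noteq> Id_on \<Omega>" for w
  proof -
    have wS: "w \<in> S" "w \<subseteq> u O converse u" using w(1) in_S by auto
    obtain \<delta> where \<delta>: "(\<alpha>, \<delta>) \<in> w" using S wS(1) \<alpha> by (rule basic_total)
    then have "\<delta> = \<alpha> \<or> \<delta> = \<gamma>1 \<or> \<delta> = \<gamma>2" using wS(2) nb by (metis subsetD)
    then consider "\<delta> = \<gamma>1" | "\<delta> = \<gamma>2" using not_Id[OF wS(1) w(2)] \<delta> by metis
    then show ?thesis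
    proof cases
      case 1
      then show ?thesis using scheme_disjoint[OF S wS(1) v(1) \<delta>] v(2) by simp
    next
      case 2
      then show ?thesis using no_split[OF wS(1) v(1) w(2) wS(2) \<delta> v(2)] by simp
    qed
  qed
  have "Id_on \<Omega> \<in> complex_product S u (converse u)"
    using in_iff[OF scheme_Id[OF S], of \<alpha>] \<alpha> by auto
  then have "complex_product S u (converse u) = {Id_on \<Omega>, v}"
    using uniq v_in by blast
  with v(1) vne that show thesis by blast
qed

text \<open>For symmetry: the product of u with its transpose is symmetric, so transposition
  permutes its two basic relations. It fixes the diagonal, hence also the other one.\<close>

lemma perp_props:
  assumes S: "scheme \<Omega> S" and u: "u \<in> basic_of_valency \<Omega> S 2"
  shows "perp \<Omega> S u \<in> S" "perp \<Omega> S u \<noteq> Id_on \<Omega>" "converse (perp \<Omega> S u) = perp \<Omega> S u"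
proof -
  obtain v where v: "v \<in> S" "v \<noteq> Id_on \<Omega>" "complex_product S u (converse u) = {Id_on \<Omega>, v}"
    using S u by (rule perp_exists)
  have perp: "perp \<Omega> S u = v"
    unfolding perp_def using v by (intro the_equality) (auto simp: doubleton_eq_iff)
  show "perp \<Omega> S u \<in> S" "perp \<Omega> S u \<noteq> Id_on \<Omega>" using v perp by auto
  have "v \<subseteq> u O converse u" using v(3) by (auto simp: complex_product_def)
  then have "converse v \<subseteq> u O converse u" by blast
  then have "converse v \<in> {Id_on \<Omega>, v}"
    using scheme_converse[OF S v(1)] unfolding v(3)[symmetric] complex_product_def by blast
  then show "converse (perp \<Omega> S u) = perp \<Omega> S u"
    using v(2) perp by (metis converse_Id_on converse_converse insertE singletonD)
qed

section \<open>Thinness forced by a product equal to the identity\<close>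

text \<open>Each point \<alpha> has some r-predecessor \<delta>, and the identity then forces every
  v-neighbour of \<alpha> to be \<delta>.\<close>

lemma thin_if_comp_Id:
  assumes S: "scheme \<Omega> S" and R: "\<Omega> \<subseteq> Range r" and "v \<in> S" "r O v = Id_on \<Omega>"
  shows "v \<in> basic_of_valency \<Omega> S 1"
proof (rule thinI[OF S \<open>v \<in> S\<close>])
  fix \<alpha> \<beta> \<gamma> assume v: "(\<alpha>, \<beta>) \<in> v" "(\<alpha>, \<gamma>) \<in> v"
  then obtain \<delta> where "(\<delta>, \<alpha>) \<in> r"
    using scheme_subset(1)[OF S \<open>v \<in> S\<close>] R by blast
  with v have "(\<delta>, \<beta>) \<in> Id_on \<Omega>" "(\<delta>, \<gamma>) \<in> Id_on \<Omega>" using assms(4) by blast+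
  then show "\<beta> = \<gamma>" by blast
qed

lemma basic_Range:
  assumes "scheme \<Omega> S" "u \<in> S"
  shows "\<Omega> \<subseteq> Range u"
proof
  fix \<beta> assume "\<beta> \<in> \<Omega>"
  with assms(1) scheme_converse[OF assms] obtain \<alpha> where "(\<beta>, \<alpha>) \<in> converse u"
    by (rule basic_total)
  then show "\<beta> \<in> Range u" by auto
qed

text \<open>\<open>thin_if_comp_Id\<close> treats the last factor of a product. It applies to c
  directly and to a after transposition, which by symmetry only reverses the order of the factors.
  The middle factor is then the thin product \<open>a O c\<close>.\<close>

lemma symmetric_product_Id_thin:
  assumes S: "scheme \<Omega> S" and mem: "a \<in> S" "b \<in> S" "c \<in> S"
    and sym: "converse a = a" "converse b = b" "converse c = c"
    and prod: "a O b O c = Id_on \<Omega>"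
  shows "a \<in> basic_of_valency \<Omega> S 1" "b \<in> basic_of_valency \<Omega> S 1" "c \<in> basic_of_valency \<Omega> S 1"
    and "a O b = c"
proof -
  have "converse (a O b O c) = Id_on \<Omega>" using prod by simp
  then have rev: "(c O b) O a = Id_on \<Omega>"
    using sym by (simp add: converse_relcomp)
  have R: "\<Omega> \<subseteq> Range (x O y)" if "x \<in> S" "y \<in> S" for x y
    using basic_Range[OF S that(1)] basic_Range[OF S that(2)] scheme_subset(1)[OF S that(2)]
    by blast
  show c: "c \<in> basic_of_valency \<Omega> S 1"
    using thin_if_comp_Id[OF S R[OF mem(1,2)] mem(3)] prod by (simp add: O_assoc)
  show a: "a \<in> basic_of_valency \<Omega> S 1"
    using thin_if_comp_Id[OF S R[OF mem(3,2)] mem(1) rev] .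
  have sq: "x O x = Id_on \<Omega>" if "x \<in> basic_of_valency \<Omega> S 1" "converse x = x" for x
    using thin_converse_comp[OF S that(1)] that(2) by simp
  \<comment> \<open>Prefixing \<open>a O a\<close>, the identity, exposes the known triple
    product.\<close>
  have "b O c = a O (a O b O c)"
    using basic_comp_Id(1)[OF S mem(2)] sq[OF a sym(1)] by (simp flip: O_assoc)
  then have bc: "b O c = a"
    using prod basic_comp_Id(2)[OF S mem(1)] by simp
  then have "b = a O c"
    using basic_comp_Id(2)[OF S mem(2)] sq[OF c sym(3)] by (metis O_assoc)
  then show "b \<in> basic_of_valency \<Omega> S 1"
    using thin_comp[OF S a c] by simp
  show "a O b = c"
    using \<open>b = a O c\<close> sq[OF a sym(1)] basic_comp_Id(1)[OF S mem(3)] by (metis O_assoc)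
qed

section \<open>Exceptional triangles and Klein four-groups\<close>

theorem theorem7p2:
  fixes \<Omega> :: "'a set" and S :: "'a rel set" and T :: "'a rel set"
  assumes "quasi_thin \<Omega> S"
    and "scheme_triangle \<Omega> S T"
  shows "exceptional \<Omega> S T \<longleftrightarrow>
    subgroup ({Id_on \<Omega>} \<union> perp \<Omega> S ` T) (thin_group \<Omega> S) \<and>
    (thin_group \<Omega> S)\<lparr>carrier := {Id_on \<Omega>} \<union> perp \<Omega> S ` T\<rparr> \<cong> klein_four_group"
    (is "_ \<longleftrightarrow> subgroup ?H ?G \<and> ?G\<lparr>carrier := ?H\<rparr> \<cong> _")
proof -
  have S: "scheme \<Omega> S" using assms(1) by (simp add: quasi_thin_def)
  interpret G: group ?G using S by (rule group_thin_group)
  have perp: "perp \<Omega> S u \<in> S" "perp \<Omega> S u \<noteq> Id_on \<Omega>" "converse (perp \<Omega> S u) = perp \<Omega> S u"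
    if "u \<in> T" for u
    using perp_props[OF S] assms(2) that by (auto simp: scheme_triangle_def)
  have sq: "perp \<Omega> S u O perp \<Omega> S u = Id_on \<Omega>"
    if "u \<in> T" "perp \<Omega> S u \<in> basic_of_valency \<Omega> S 1" for u
    using thin_converse_comp[OF S that(2)] perp(3)[OF that(1)] by simp
  show ?thesis
  proof (intro iffI; (elim conjE)?)
    assume "exceptional \<Omega> S T"
    then obtain u v w where T: "T = {u, v, w}"
      and prod: "perp \<Omega> S u O perp \<Omega> S v O perp \<Omega> S w = Id_on \<Omega>"
      by (auto simp: exceptional_def)
    define a b c where "a = perp \<Omega> S u" and "b = perp \<Omega> S v" and "c = perp \<Omega> S w"
    note defs = a_def b_def c_def
    have H: "?H = {Id_on \<Omega>, a, b, c}" using T by (auto simp: defs)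
    have thin: "a \<in> carrier ?G" "b \<in> carrier ?G" "c \<in> carrier ?G" and ab: "a O b = c"
      using symmetric_product_Id_thin[OF S, of a b c] perp prod T by (auto simp: defs)
    have sqs: "a O a = Id_on \<Omega>" "b O b = Id_on \<Omega>" "c O c = Id_on \<Omega>"
      using sq thin T by (auto simp: defs)
    have ne: "a \<noteq> Id_on \<Omega>" "b \<noteq> Id_on \<Omega>" "c \<noteq> Id_on \<Omega>"
      using perp(2) T by (auto simp: defs)
    \<comment> \<open>If a and b coincided, c would be \<open>a O a\<close>, the identity.\<close>
    then have "a \<noteq> b" using sqs ab by auto
    \<comment> \<open>Transposing \<open>a O b = c\<close> reverses the factors, and all three
      relations are symmetric.\<close>
    have ba: "b O a = c"
      using ab perp(3) T by (metis converse_relcomp defs insertCI)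
    have units: "Id_on \<Omega> O x = x" "x O Id_on \<Omega> = x" if "x \<in> {Id_on \<Omega>, a, b, c}" for x
      using that thin Id_thin[OF S] basic_comp_Id[OF S] by (auto simp: basic_of_valency_def)
    \<comment> \<open>The rest of the multiplication table: replace c by \<open>a O b\<close> or
      \<open>b O a\<close> and cancel a square.\<close>
    have mults: "a O c = b" "b O c = a" "c O a = b" "c O b = a"
    proof -
      have "a O a O b = b" "b O b O a = a"
        using units by (simp_all add: sqs flip: O_assoc)
      then show "a O c = b" "b O c = a" using ab ba by simp_all
      have "(b O a) O a = b" "(a O b) O b = a"
        using units by (simp_all add: sqs O_assoc)
      then show "c O a = b" "c O b = a" using ab ba by simp_all
    qed
    have invs: "inv\<^bsub>?G\<^esub> x = x" if "x \<in> ?H" for x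
      using that sqs thin G.one_closed unfolding H by (intro G.inv_equality) auto
    have sub: "subgroup ?H ?G"
    proof (rule subgroup.intro)
      show "?H \<subseteq> carrier ?G" unfolding H using thin G.one_closed by auto
      show "x \<otimes>\<^bsub>?G\<^esub> y \<in> ?H" if "x \<in> ?H" "y \<in> ?H" for x y
        using that unfolding H
        by (elim insertE emptyE) (simp_all add: ab ba mults sqs units)
    qed (use invs in auto)
    moreover have "?G\<lparr>carrier := ?H\<rparr> \<cong> klein_four_group"
      unfolding H
      by (rule klein_four_groupI[OF G.subgroup_imp_group[OF sub[unfolded H]], of a b])
        (simp_all add: ab ba ne sqs \<open>a \<noteq> b\<close>)
    ultimately show "subgroup ?H ?G \<and> ?G\<lparr>carrier := ?H\<rparr> \<cong> klein_four_group" ..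
  next
    assume sub: "subgroup ?H ?G" and iso: "?G\<lparr>carrier := ?H\<rparr> \<cong> klein_four_group"
    obtain u v w where T: "T = {u, v, w}"
      using assms(2) by (auto simp: scheme_triangle_def card_3_iff)
    define a b c where "a = perp \<Omega> S u" and "b = perp \<Omega> S v" and "c = perp \<Omega> S w"
    note defs = a_def b_def c_def
    have H: "?H = {Id_on \<Omega>, a, b, c}" using T by (auto simp: defs)
    \<comment> \<open>The isomorphism supplies the order of \<open>?H\<close>, which rules out a =
      b; that a and c are involutions comes from \<open>sq\<close>.\<close>
    have card_H: "card {Id_on \<Omega>, a, b, c} = 4"
      using iso_same_card[OF iso] card_klein_four_group unfolding H by simp
    have distinct: "a \<noteq> b"
    proof
      assume "a = b"
      then have "card {Id_on \<Omega>, a, b, c} \<le> 3"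
        by (simp add: card_insert_if)
      then show False using card_H by simp
    qed
    have thin: "a \<in> carrier ?G" "b \<in> carrier ?G" "c \<in> carrier ?G"
      using subgroup.subset[OF sub] unfolding H by auto
    have sqs: "a O a = Id_on \<Omega>" "c O c = Id_on \<Omega>"
      using sq thin T by (auto simp: defs)
    have ne: "a \<noteq> Id_on \<Omega>" "b \<noteq> Id_on \<Omega>"
      using perp(2) T by (auto simp: defs)
    have "a O b \<in> {Id_on \<Omega>, a, b, c}"
      using subgroup.m_closed[OF sub, of a b] unfolding H by simp
    \<comment> \<open>Elimination inside \<open>?H\<close>: a product equal to the identity, which
      is \<open>a O a\<close>, would give a = b by cancellation; a product equal to a or to b would
      make the other factor the identity. Only c remains.\<close>
    moreover have "a O b \<noteq> Id_on \<Omega>"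
      using G.l_cancel[of a a b] distinct sqs thin by auto
    moreover have "a O b \<noteq> a" "a O b \<noteq> b"
      using G.l_cancel_one[of a b] G.r_cancel_one[of b a] ne thin by simp_all
    ultimately have "a O b = c" by blast
    then have "a O b O c = Id_on \<Omega>" using sqs by (simp flip: O_assoc)
    then show "exceptional \<Omega> S T"
      using assms(2) T unfolding exceptional_def defs by blast
  qed
qed

end
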